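(* Fix $p\in[\frac12,1)$ and let $q:=1-p$. Let $(S_n)_{n\ge 0}$ be the simple random walk on $\mathbb{Z}$ with $S_0=0$ and mutually independent increments $X_n=S_n-S_{n-1}$ satisfying $\mathbb{P}[X_n=+1]=p$ and $\mathbb{P}[X_n=-1]=q$ for $n\ge 1$. Let $R_n:=\#\{1\le k\le n: X_k=+1\}$ and, for each positive integer $d$, let $N_d:=\inf\{n\ge 0: S_n=d\}$. Then $$ \mathbb{E}\left[\frac{R_{N_d}}{N_d}\right]>\mathbb{E}\left[\frac{R_{N_{d+1}}}{N_{d+1}}\right] $$ for any positive integer $d$; moreover, $$ \lim_{d\to\infty}\mathbb{E}\left[\frac{R_{N_d}}{N_d}\right]=p \quad\text{and}\quad \lim_{d\to\infty}\operatorname{Var}\left[\frac{R_{N_d}}{N_d}\right]=0. $$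
   Context: For $p\ge \frac12$, the hitting time $N_d$ is almost surely finite, so $R_{N_d}/N_d$ is almost surely well defined (its value on the null event $\{N_d=\infty\}$ is irrelevant). $R_{N_d}$ denotes $R_n$ evaluated at $n=N_d$. *)

theory Defs
  imports "HOL-Probability.Probability"
begin

text \<open>A walk is given by its positions \<open>S n \<omega>\<close>. Steps are indexed from \<open>1\<close>; because of
  truncated subtraction \<open>step S 0\<close> is identically \<open>0\<close>, and it plays no role below.\<close>

definition step :: "(nat \<Rightarrow> 'a \<Rightarrow> int) \<Rightarrow> nat \<Rightarrow> 'a \<Rightarrow> int" where
  "step S n \<omega> = S n \<omega> - S (n - 1) \<omega>"

definition up_steps :: "(nat \<Rightarrow> 'a \<Rightarrow> int) \<Rightarrow> nat \<Rightarrow> 'a \<Rightarrow> nat" where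
  "up_steps S n \<omega> = card {k \<in> {1..n}. step S k \<omega> = 1}"

text \<open>The infimum is taken in the extended naturals, so it is \<open>\<infinity>\<close> if the level is never hit.\<close>

definition hitting_time :: "(nat \<Rightarrow> 'a \<Rightarrow> int) \<Rightarrow> int \<Rightarrow> 'a \<Rightarrow> enat" where
  "hitting_time S x \<omega> = Inf {enat n | n. S n \<omega> = x}"

text \<open>The proportion of up-steps at the time level \<open>d\<close> is first hit. The value on the event
  that \<open>d\<close> is never hit, which is null for upward or zero drift, is set to \<open>0\<close>.\<close>

definition up_ratio :: "(nat \<Rightarrow> 'a \<Rightarrow> int) \<Rightarrow> nat \<Rightarrow> 'a \<Rightarrow> real" where
  "up_ratio S d \<omega> =
    (case hitting_time S (int d) \<omega> of
       enat n \<Rightarrow> real (up_steps S n \<omega>) / real n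
     | \<infinity> \<Rightarrow> 0)"

end

theory Submission
  imports Defs "HOL-Real_Asymp.Real_Asymp"
begin

text \<open>
  Let \<open>T\<close> be the hitting time of \<open>d\<close>. At time \<open>T\<close> there are \<open>d\<close> more up-steps than down-steps, so the
  ratio is \<open>1/2 + d/(2 T)\<close>. For \<open>0 < u < 1\<close> put \<open>\<sigma>(u) = u / (p + q u\<^sup>2)\<close>. Since \<open>p/u + q u = 1/\<sigma>(u)\<close>,
  the process \<open>\<sigma>(u)\<^sup>n u\<^bsup>d - S n\<^esup>\<close> is a martingale, and stopping it at \<open>T\<close> gives
  \<open>E[\<sigma>(u)\<^sup>T] = u\<^sup>d\<close>; letting \<open>u\<close> tend to \<open>1\<close> shows that \<open>T\<close> is almost surely finite.

  As \<open>\<sigma>\<close> maps \<open>[0,1]\<close> onto itself, \<open>1/T\<close> is the integral of \<open>\<sigma>\<^bsup>T-1\<^esup> \<sigma>'\<close> over \<open>[0,1]\<close>, so by Fubini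
  \<open>E[d/T]\<close> is the integral of \<open>d u\<^bsup>d-1\<^esup> g(u)\<close>, with \<open>g(u) = (p - q u\<^sup>2) / (p + q u\<^sup>2)\<close>. Integration by
  parts turns this into \<open>p - q\<close> plus the integral of \<open>u\<^sup>d (-g'(u))\<close>, which is strictly decreasing in
  \<open>d\<close> and tends to \<open>p - q\<close>. For the variance, \<open>1/T\<^sup>2\<close> is bounded by \<open>1/(T (T-1))\<close>, which is the integral
  of \<open>\<sigma>\<^bsup>T-2\<^esup> (1 - \<sigma>) \<sigma>'\<close> and is treated in the same way.
\<close>

section \<open>Calculus on the unit interval, measurability of integer sums, hitting times as least
  indices\<close>

lemma has_integral_FTC_01:
  fixes f :: "real \<Rightarrow> real"
  assumes "\<And>u. u \<in> {0..1} \<Longrightarrow> (f has_real_derivative f' u) (at u)"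
  shows "(f' has_integral f 1 - f 0) {0..1}"
  by (rule fundamental_theorem_of_calculus)
    (use assms in \<open>auto simp flip: has_real_derivative_iff_has_vector_derivative intro: has_field_derivative_at_within\<close>)

lemma has_integral_power_01: "((\<lambda>u::real. u ^ n) has_integral 1 / (real n + 1)) {0..1}"
proof -
  have "((\<lambda>u::real. u ^ n) has_integral 1 ^ Suc n / (real n + 1) - 0 ^ Suc n / (real n + 1)) {0..1}"
  proof (rule has_integral_FTC_01)
    show "((\<lambda>u. u ^ Suc n / (real n + 1)) has_real_derivative u ^ n) (at u)" for u
      using DERIV_cdivide[OF DERIV_pow[of "Suc n" u], of "real n + 1"] by (simp add: add.commute)
  qed
  then show ?thesis by simp
qed

text \<open>Induction on the index set: each addition is split over the countably many values of the
  remaining sum.\<close>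

lemma measurable_int_sum [measurable (raw)]:
  fixes f :: "'i \<Rightarrow> 'a \<Rightarrow> int"
  assumes "\<And>i. i \<in> I \<Longrightarrow> f i \<in> measurable N (count_space UNIV)"
  shows "(\<lambda>x. \<Sum>i\<in>I. f i x) \<in> measurable N (count_space UNIV)"
proof (cases "finite I")
  case True
  then show ?thesis using assms
  proof (induction I rule: finite_induct)
    case (insert i I)
    have "(\<lambda>x. f i x + (\<Sum>i\<in>I. f i x)) \<in> measurable N (count_space UNIV)"
    proof (rule measurable_compose_countable[where f="\<lambda>j x. f i x + j" and g="\<lambda>x. \<Sum>i\<in>I. f i x"])
      show "(\<lambda>x. f i x + j) \<in> measurable N (count_space UNIV)" for j
        using insert.prems[of i] by (rule measurable_compose) auto
    qed (use insert in auto)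
    with insert show ?case by simp
  qed auto
qed auto

lemma hitting_time_eq_Least:
  "hitting_time S x \<omega> = (if \<exists>n. S n \<omega> = x then enat (LEAST n. S n \<omega> = x) else \<infinity>)"
proof (cases "\<exists>n. S n \<omega> = x")
  case True
  have "Inf {enat n | n. S n \<omega> = x} = enat (LEAST n. S n \<omega> = x)"
  proof (rule Inf_eqI)
    show "enat (LEAST n. S n \<omega> = x) \<le> i" if "i \<in> {enat n | n. S n \<omega> = x}" for i
      using that by (auto intro: Least_le)
    show "y \<le> enat (LEAST n. S n \<omega> = x)"
      if "\<And>i. i \<in> {enat n | n. S n \<omega> = x} \<Longrightarrow> y \<le> i" for y
      using LeastI_ex[OF True] that[of "enat (LEAST n. S n \<omega> = x)"] by blast
  qed
  with True show ?thesis by (simp add: hitting_time_def)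
next
  case False
  then show ?thesis by (simp add: hitting_time_def top_enat_def)
qed

section \<open>The walk, the function \<sigma> and basic measurability\<close>

locale biased_walk = prob_space M
  for M :: "'a measure" +
  fixes S :: "nat \<Rightarrow> 'a \<Rightarrow> int" and p q :: real
  assumes p_ge: "1 / 2 \<le> p" and p_less: "p < 1" and q_eq: "q = 1 - p"
    and start: "\<omega> \<in> space M \<Longrightarrow> S 0 \<omega> = 0"
    and indep: "indep_vars (\<lambda>_. count_space UNIV) (step S) {1..}"
    and prob_up: "n \<ge> 1 \<Longrightarrow> prob {\<omega> \<in> space M. step S n \<omega> = 1} = p"
    and prob_down: "n \<ge> 1 \<Longrightarrow> prob {\<omega> \<in> space M. step S n \<omega> = - 1} = q"
begin

definition \<sigma> :: "real \<Rightarrow> real" where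
  "\<sigma> u = u / (p + q * u\<^sup>2)"

text \<open>On paths that never hit \<open>d\<close> the value of \<open>T\<close> is unspecified.\<close>

definition T :: "nat \<Rightarrow> 'a \<Rightarrow> nat" where
  "T d \<omega> = (LEAST n. S n \<omega> = int d)"

lemma q_pos: "0 < q" and p_pos: "0 < p" and q_le_p: "q \<le> p"
  using p_ge p_less q_eq by auto

lemma denom_pos: "0 < p + q * u\<^sup>2"
  using p_pos q_pos by (simp add: add_pos_nonneg)

lemma sigma_pos: "0 < u \<Longrightarrow> 0 < \<sigma> u"
  by (simp add: \<sigma>_def denom_pos)

text \<open>Because \<open>p + q = 1\<close>, the quadratic \<open>p - u + q * u\<^sup>2\<close> has
  the root \<open>1\<close>. The factorization yields the upper bounds on \<sigma> and returns in
  the second moment.\<close>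

lemma one_minus_sigma: "1 - \<sigma> u = (1 - u) * (p - q * u) / (p + q * u\<^sup>2)"
proof -
  have "p + q * u\<^sup>2 - u = (1 - u) * (p - q * u)"
    by (simp add: q_eq algebra_simps power2_eq_square)
  then show ?thesis
    using denom_pos[of u] by (simp add: \<sigma>_def diff_frac_eq flip: \<open>p + q * u\<^sup>2 - u = _\<close>) (simp add: diff_divide_distrib)
qed

lemma sigma_le_1: "0 \<le> u \<Longrightarrow> u \<le> 1 \<Longrightarrow> \<sigma> u \<le> 1"
proof -
  assume "0 \<le> u" "u \<le> 1"
  then have "q * u \<le> q * 1" using q_pos by (intro mult_left_mono) auto
  then have "0 \<le> (1 - u) * (p - q * u) / (p + q * u\<^sup>2)"
    using denom_pos[of u] q_le_p \<open>u \<le> 1\<close> by (intro divide_nonneg_pos mult_nonneg_nonneg) auto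
  then show ?thesis using one_minus_sigma[of u] by linarith
qed

text \<open>For \<open>u < 1\<close> the factor \<open>p - q * u\<close> is positive even when
  \<open>p = q\<close>. Strictness later makes \<open>survival\<close> vanish geometrically.\<close>

lemma sigma_less_1: "0 \<le> u \<Longrightarrow> u < 1 \<Longrightarrow> \<sigma> u < 1"
proof -
  assume "0 \<le> u" "u < 1"
  then have "q * u < q * 1" using q_pos by (intro mult_strict_left_mono) auto
  then have "0 < (1 - u) * (p - q * u) / (p + q * u\<^sup>2)"
    using denom_pos[of u] q_le_p \<open>u < 1\<close> by (intro divide_pos_pos mult_pos_pos) auto
  then show ?thesis using one_minus_sigma[of u] by linarith
qed

lemma measurable_step [measurable]: "n \<ge> 1 \<Longrightarrow> step S n \<in> measurable M (count_space UNIV)"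
  using indep by (auto simp: indep_vars_def)

lemma walk_eq_sum: "\<omega> \<in> space M \<Longrightarrow> S n \<omega> = (\<Sum>k=1..n. step S k \<omega>)"
  by (induction n) (auto simp: start step_def)

lemma measurable_walk [measurable]: "S n \<in> measurable M (count_space UNIV)"
proof -
  have "(\<lambda>\<omega>. \<Sum>k=1..n. step S k \<omega>) \<in> measurable M (count_space UNIV)"
    by (rule measurable_int_sum) auto
  then show ?thesis
    by (subst measurable_cong) (auto simp: walk_eq_sum)
qed

lemma measurable_T [measurable]: "T d \<in> measurable M (count_space UNIV)"
  unfolding T_def by measurable

text \<open>The two prescribed probabilities add up to \<open>1\<close>, which leaves no mass for
  other integer steps.\<close>

lemma AE_step: assumes "n \<ge> 1" shows "AE \<omega> in M. step S n \<omega> = 1 \<or> step S n \<omega> = - 1"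
proof -
  note [measurable] = measurable_step[OF assms]
  have "prob {\<omega> \<in> space M. step S n \<omega> = 1 \<or> step S n \<omega> = - 1} =
     prob ({\<omega> \<in> space M. step S n \<omega> = 1} \<union> {\<omega> \<in> space M. step S n \<omega> = - 1})"
    by (rule arg_cong[where f=prob]) auto
  also have "\<dots> = p + q"
    using prob_up[OF assms] prob_down[OF assms] by (subst finite_measure_Union) auto
  finally have "prob {\<omega> \<in> space M. step S n \<omega> = 1 \<or> step S n \<omega> = - 1} = 1"
    by (simp add: q_eq)
  then show ?thesis by (subst (asm) prob_Collect_eq_1) auto
qed

section \<open>Pathwise facts about walks with unit steps\<close>

definition simple_path :: "'a \<Rightarrow> bool" where
  "simple_path \<omega> \<longleftrightarrow> S 0 \<omega> = 0 \<and> (\<forall>n. S (Suc n) \<omega> = S n \<omega> + 1 \<or> S (Suc n) \<omega> = S n \<omega> - 1)"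

text \<open>Countably many almost sure conditions hold jointly, so null sets are dealt with once and
  the later arguments can be pathwise.\<close>

lemma AE_simple_path: "AE \<omega> in M. simple_path \<omega>"
proof -
  have "AE \<omega> in M. \<forall>n. step S (Suc n) \<omega> = 1 \<or> step S (Suc n) \<omega> = - 1"
    by (subst AE_all_countable) (auto intro: AE_step)
  then show ?thesis
  proof (rule AE_mp, intro AE_I2 impI)
    fix \<omega> assume "\<omega> \<in> space M" and *: "\<forall>n. step S (Suc n) \<omega> = 1 \<or> step S (Suc n) \<omega> = - 1"
    show "simple_path \<omega>"
      unfolding simple_path_def
    proof (intro conjI allI)
      show "S (Suc n) \<omega> = S n \<omega> + 1 \<or> S (Suc n) \<omega> = S n \<omega> - 1" for n
        using *[rule_format, of n] by (auto simp: step_def)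
    qed (use start \<open>\<omega> \<in> space M\<close> in auto)
  qed
qed

lemma simple_path_le: "simple_path \<omega> \<Longrightarrow> S n \<omega> \<le> int n"
proof (induction n)
  case (Suc n)
  have "S (Suc n) \<omega> = S n \<omega> + 1 \<or> S (Suc n) \<omega> = S n \<omega> - 1"
    using Suc.prems by (auto simp: simple_path_def)
  with Suc show ?case by auto
qed (auto simp: simple_path_def)

text \<open>Unit steps cannot jump over the level. Hence the exponent of \<open>u\<close> in
  \<open>survival\<close> is positive as long as the level is unhit.\<close>

lemma simple_path_less:
  assumes "simple_path \<omega>" "d > 0" "\<forall>k\<le>n. S k \<omega> \<noteq> int d"
  shows "S n \<omega> < int d"
  using assms(3)
proof (induction n)
  case 0
  then show ?case using assms by (auto simp: simple_path_def)
next
  case (Suc n)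
  then have "S n \<omega> < int d" "S (Suc n) \<omega> \<noteq> int d" by auto
  moreover have "S (Suc n) \<omega> = S n \<omega> + 1 \<or> S (Suc n) \<omega> = S n \<omega> - 1"
    using assms(1) by (auto simp: simple_path_def)
  ultimately show ?case by linarith
qed

text \<open>An up-step adds \<open>2\<close> to both sides, a down-step adds
  \<open>0\<close>.\<close>

lemma up_steps_simple_path:
  assumes "simple_path \<omega>" shows "2 * int (up_steps S n \<omega>) = int n + S n \<omega>"
proof (induction n)
  case 0
  then show ?case using assms by (simp add: simple_path_def up_steps_def)
next
  case (Suc n)
  have *: "{k \<in> {1..Suc n}. step S k \<omega> = 1} = {k \<in> {1..n}. step S k \<omega> = 1} \<union>
      (if step S (Suc n) \<omega> = 1 then {Suc n} else {})"
    by (auto simp: le_Suc_eq)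
  have "up_steps S (Suc n) \<omega> = up_steps S n \<omega> + (if step S (Suc n) \<omega> = 1 then 1 else 0)"
    unfolding up_steps_def * by (subst card_Un_disjoint) auto
  moreover have "S (Suc n) \<omega> = S n \<omega> + 1 \<or> S (Suc n) \<omega> = S n \<omega> - 1"
    using assms by (auto simp: simple_path_def)
  ultimately show ?case using Suc by (auto simp: step_def)
qed

section \<open>The stopped exponential martingale\<close>

definition unhit :: "nat \<Rightarrow> nat \<Rightarrow> 'a \<Rightarrow> bool" where
  "unhit d n \<omega> \<longleftrightarrow> (\<forall>k\<le>n. S k \<omega> \<noteq> int d)"

lemma measurable_unhit [measurable]: "Measurable.pred M (unhit d n)"
  unfolding unhit_def by measurable

text \<open>Restricted to paths that hit the level, since \<open>T\<close> is unspecified on the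
  others. For this reason \<open>unhit\<close> is phrased through positions, which also makes it
  depend on the first \<open>n\<close> positions after the start only.\<close>

lemma unhit_eq_T: "(\<exists>n. S n \<omega> = int d) \<Longrightarrow> unhit d n \<omega> \<longleftrightarrow> n < T d \<omega>"
  unfolding unhit_def T_def
  by (metis (mono_tags, lifting) LeastI_ex not_less_Least leI le_less_trans linorder_not_less)

lemma T_eqI: "S n \<omega> = int d \<Longrightarrow> (\<And>k. k < n \<Longrightarrow> S k \<omega> \<noteq> int d) \<Longrightarrow> T d \<omega> = n"
  unfolding T_def by (metis (mono_tags, lifting) LeastI_ex not_less_Least linorder_neqE_nat)

text \<open>The stopped martingale at time \<open>n\<close> is \<open>survival + stopped\<close>.\<close>

definition survival :: "nat \<Rightarrow> real \<Rightarrow> nat \<Rightarrow> 'a \<Rightarrow> real" where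
  "survival d u n \<omega> = \<sigma> u ^ n * u powi (int d - S n \<omega>) * of_bool (unhit d n \<omega>)"

text \<open>No power of \<open>u\<close> appears, because its exponent
  \<open>int d - S n \<omega>\<close> vanishes at the hitting time.\<close>

definition stopped :: "nat \<Rightarrow> real \<Rightarrow> nat \<Rightarrow> 'a \<Rightarrow> real" where
  "stopped d u n \<omega> = \<sigma> u ^ T d \<omega> * of_bool (\<not> unhit d n \<omega>)"

lemma measurable_survival [measurable]: "survival d u n \<in> borel_measurable M"
proof -
  have "(\<lambda>\<omega>. u powi (int d - S n \<omega>)) \<in> borel_measurable M"
    by (rule measurable_compose[OF measurable_walk]) auto
  then show ?thesis unfolding survival_def[abs_def] by measurable
qed

lemma measurable_stopped [measurable]: "stopped d u n \<in> borel_measurable M"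
proof -
  have "(\<lambda>\<omega>. \<sigma> u ^ T d \<omega>) \<in> borel_measurable M"
    by (rule measurable_compose[OF measurable_T]) auto
  then show ?thesis unfolding stopped_def[abs_def] by measurable
qed

text \<open>Below the level the power of \<open>u\<close> is at most \<open>1\<close>, so only
  \<open>\<sigma> u ^ n\<close> remains. This gives both integrability and the limit
  \<open>0\<close>.\<close>

lemma survival_bounds:
  assumes u: "0 < u" "u < 1" and "d > 0" "simple_path \<omega>"
  shows "0 \<le> survival d u n \<omega>" "survival d u n \<omega> \<le> \<sigma> u ^ n"
proof -
  show "0 \<le> survival d u n \<omega>"
    using u sigma_pos[of u] by (simp add: survival_def)
  show "survival d u n \<omega> \<le> \<sigma> u ^ n"
  proof (cases "unhit d n \<omega>")
    case True
    then have "S n \<omega> < int d"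
      using assms by (auto simp: unhit_def intro!: simple_path_less)
    then have "u powi (int d - S n \<omega>) = u ^ nat (int d - S n \<omega>)"
      by (simp add: power_int_def)
    also have "\<dots> \<le> 1" using u by (simp add: power_le_one)
    finally show ?thesis
      using True sigma_pos[of u] u by (simp add: survival_def mult_left_le)
  next
    case False
    then show ?thesis using sigma_pos[of u] u by (simp add: survival_def)
  qed
qed

lemma stopped_bounds:
  assumes u: "0 < u" "u < 1"
  shows "0 \<le> stopped d u n \<omega>" "stopped d u n \<omega> \<le> 1"
  using sigma_pos[of u] sigma_le_1[of u] u by (auto simp: stopped_def power_le_one)

lemma integrable_survival:
  assumes "0 < u" "u < 1" "d > 0" shows "integrable M (survival d u n)"
proof (rule integrable_const_bound)
  show "AE \<omega> in M. norm (survival d u n \<omega>) \<le> \<sigma> u ^ n"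
    using AE_simple_path survival_bounds[OF assms] by (auto elim!: eventually_mono)
qed auto

lemma integrable_stopped:
  assumes "0 < u" "u < 1" shows "integrable M (stopped d u n)"
  by (rule integrable_const_bound[where B=1]) (use stopped_bounds[OF assms] in auto)

lemma expectation_step:
  assumes "0 < u" "n \<ge> 1"
  shows "expectation (\<lambda>\<omega>. u powi (- step S n \<omega>)) = 1 / \<sigma> u"
    "integrable M (\<lambda>\<omega>. u powi (- step S n \<omega>))"
proof -
  note [measurable] = measurable_step[OF assms(2)]
  let ?f = "\<lambda>\<omega>. inverse u * indicator {\<omega> \<in> space M. step S n \<omega> = 1} \<omega> +
      u * indicator {\<omega> \<in> space M. step S n \<omega> = - 1} \<omega>"
  have m [measurable]: "(\<lambda>\<omega>. u powi (- step S n \<omega>)) \<in> borel_measurable M"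
    by (rule measurable_compose[OF measurable_step[OF assms(2)]]) auto
  have int: "integrable M ?f"
    by (intro Bochner_Integration.integrable_add integrable_mult_right integrable_real_indicator)
      (auto simp: emeasure_eq_measure)
  have ae: "AE \<omega> in M. u powi (- step S n \<omega>) = ?f \<omega>"
    using AE_step[OF assms(2)] AE_space by eventually_elim (auto simp: power_int_minus)
  have "expectation (\<lambda>\<omega>. u powi (- step S n \<omega>)) = expectation ?f"
    by (rule integral_cong_AE) (use ae in auto)
  also have "\<dots> = inverse u * p + u * q"
    using prob_up[OF assms(2)] prob_down[OF assms(2)]
    by (subst Bochner_Integration.integral_add)
      (auto intro!: integrable_mult_right integrable_real_indicator simp: emeasure_eq_measure)
  also have "\<dots> = 1 / \<sigma> u"
    using assms(1) denom_pos[of u] by (simp add: \<sigma>_def field_simps power2_eq_square)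
  finally show "expectation (\<lambda>\<omega>. u powi (- step S n \<omega>)) = 1 / \<sigma> u" .
  show "integrable M (\<lambda>\<omega>. u powi (- step S n \<omega>))"
    using int ae by (subst integrable_cong_AE[where g="?f"]) auto
qed

text \<open>\<open>survival\<close> at time \<open>n\<close> is a function of the first
  \<open>n\<close> steps and hence independent of the next one, so the expectation of the product
  factors.\<close>

lemma survival_times_step:
  assumes u: "0 < u" "u < 1" and d: "d > 0"
  shows "expectation (\<lambda>\<omega>. survival d u n \<omega> * u powi (- step S (Suc n) \<omega>)) =
      expectation (survival d u n) / \<sigma> u"
    and "integrable M (\<lambda>\<omega>. survival d u n \<omega> * u powi (- step S (Suc n) \<omega>))"
proof -
  note step = expectation_step[OF u(1), of "Suc n", simplified]
  let ?N = "\<lambda>A. PiM A (\<lambda>_::nat. count_space (UNIV :: int set))"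
  \<comment> \<open>\<open>s\<close> and \<open>F\<close> rebuild the walk and
    \<open>survival\<close> from a vector of steps; independence of disjoint blocks of steps then
    applies.\<close>
  define s where "s = (\<lambda>n (x :: nat \<Rightarrow> int). \<Sum>k=1..n. x k)"
  define F where "F = (\<lambda>x. \<sigma> u ^ n * u powi (int d - s n x) * of_bool (\<forall>k\<in>{..n}. s k x \<noteq> int d))"
  define G where "G = (\<lambda>x :: nat \<Rightarrow> int. u powi (- x (Suc n)))"
  define X where "X = (\<lambda>\<omega>. F (restrict (\<lambda>i. step S i \<omega>) {1..n}))"
  have s: "s k \<in> measurable (?N {1..n}) (count_space UNIV)" if "k \<le> n" for k
    unfolding s_def using that by (intro measurable_int_sum measurable_component_singleton) auto
  have F: "F \<in> borel_measurable (?N {1..n})"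
  proof -
    have 1: "(\<lambda>x. u powi (int d - s n x)) \<in> borel_measurable (?N {1..n})"
      by (rule measurable_compose[OF s]) auto
    have "Measurable.pred (?N {1..n}) (\<lambda>x. s k x \<noteq> int d)" if "k \<le> n" for k
      by (rule measurable_compose[OF s[OF that]]) auto
    then have 2: "Measurable.pred (?N {1..n}) (\<lambda>x. \<forall>k\<in>{..n}. s k x \<noteq> int d)"
      by (intro pred_intros_finite) auto
    have 3: "(\<lambda>x. of_bool (\<forall>k\<in>{..n}. s k x \<noteq> int d) :: real) \<in> borel_measurable (?N {1..n})"
      by (rule measurable_compose[OF 2]) auto
    show ?thesis unfolding F_def by (rule borel_measurable_times[OF borel_measurable_times[OF borel_measurable_const 1] 3])
  qed
  have G: "G \<in> borel_measurable (?N {Suc n})"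
    unfolding G_def by (rule measurable_compose[OF measurable_component_singleton]) auto
  have "indep_var (?N {1..n}) (\<lambda>\<omega>. restrict (\<lambda>i. step S i \<omega>) {1..n})
      (?N {Suc n}) (\<lambda>\<omega>. restrict (\<lambda>i. step S i \<omega>) {Suc n})"
    by (rule indep_var_restrict[OF indep]) auto
  from indep_var_compose[OF this F G]
  have "indep_var borel (\<lambda>\<omega>. F (restrict (\<lambda>i. step S i \<omega>) {1..n}))
      borel (\<lambda>\<omega>. G (restrict (\<lambda>i. step S i \<omega>) {Suc n}))"
    by (simp add: comp_def)
  then have ind: "indep_var borel X
      borel (\<lambda>\<omega>. u powi (- step S (Suc n) \<omega>))"
    by (simp add: G_def X_def)
  have eq: "X \<omega> = survival d u n \<omega>" if "\<omega> \<in> space M" for \<omega>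
  proof -
    have "s k (restrict (\<lambda>i. step S i \<omega>) {1..n}) = S k \<omega>" if "k \<le> n" for k
      unfolding walk_eq_sum[OF \<open>\<omega> \<in> space M\<close>] s_def using that by (intro sum.cong) auto
    then show ?thesis unfolding X_def F_def survival_def unhit_def by auto
  qed
  have int: "integrable M X"
    using integrable_survival[OF assms, of n] by (simp add: eq cong: Bochner_Integration.integrable_cong)
  show "expectation (\<lambda>\<omega>. survival d u n \<omega> * u powi (- step S (Suc n) \<omega>)) =
      expectation (survival d u n) / \<sigma> u"
    using indep_var_lebesgue_integral[OF ind int step(2)]
    by (simp add: eq step(1) cong: Bochner_Integration.integral_cong)
  show "integrable M (\<lambda>\<omega>. survival d u n \<omega> * u powi (- step S (Suc n) \<omega>))"
    using indep_var_integrable[OF ind int step(2)]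
    by (simp add: eq cong: Bochner_Integration.integrable_cong)
qed

text \<open>A path that first hits at time \<open>Suc n\<close> moves from \<open>survival\<close>
  to \<open>stopped\<close>, with the power of \<open>u\<close> equal to \<open>1\<close> at that
  moment; a path stopped earlier keeps its value.\<close>

lemma survival_Suc_plus_stopped_Suc:
  assumes "0 < u" "simple_path \<omega>"
  shows "survival d u (Suc n) \<omega> + stopped d u (Suc n) \<omega> =
    \<sigma> u * (survival d u n \<omega> * u powi (- step S (Suc n) \<omega>)) + stopped d u n \<omega>"
proof (cases "unhit d n \<omega>")
  case True
  have eq: "u powi (int d - S (Suc n) \<omega>) = u powi (int d - S n \<omega>) * u powi (- step S (Suc n) \<omega>)"
    using assms(1) by (simp add: step_def flip: power_int_add)
  show ?thesis
  proof (cases "S (Suc n) \<omega> = int d")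
    case hit: True
    then have "T d \<omega> = Suc n"
      using True by (intro T_eqI) (auto simp: unhit_def)
    moreover have "\<not> unhit d (Suc n) \<omega>" using hit by (auto simp: unhit_def)
    ultimately show ?thesis using True eq hit by (simp add: survival_def stopped_def)
  next
    case False
    then have "unhit d (Suc n) \<omega>" using True by (auto simp: unhit_def le_Suc_eq)
    then show ?thesis using True eq by (simp add: survival_def stopped_def)
  qed
next
  case False
  then have "\<not> unhit d (Suc n) \<omega>" by (auto simp: unhit_def intro: le_SucI)
  then show ?thesis using False by (simp add: survival_def stopped_def)
qed

text \<open>The mean of the stopped martingale is constant in \<open>n\<close>, and at time
  \<open>0\<close> the martingale equals \<open>u ^ d\<close>.\<close>

lemma expectation_survival_plus_stopped:
  assumes u: "0 < u" "u < 1" and d: "d > 0"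
  shows "expectation (survival d u n) + expectation (stopped d u n) = u ^ d"
proof (induction n)
  case 0
  have "expectation (survival d u 0) = expectation (\<lambda>_. u ^ d)"
    by (intro Bochner_Integration.integral_cong) (use d in \<open>auto simp: survival_def unhit_def start\<close>)
  moreover have "expectation (stopped d u 0) = expectation (\<lambda>_. 0)"
    by (intro Bochner_Integration.integral_cong) (use d in \<open>auto simp: stopped_def unhit_def start\<close>)
  ultimately show ?case by (simp add: prob_space)
next
  case (Suc n)
  note ints = integrable_survival[OF u d] integrable_stopped[OF u]
  note int = survival_times_step[OF u d, of n]
  have "expectation (survival d u (Suc n)) + expectation (stopped d u (Suc n)) =
    expectation (\<lambda>\<omega>. survival d u (Suc n) \<omega> + stopped d u (Suc n) \<omega>)"
    by (simp add: ints)
  also have "\<dots> = expectation (\<lambda>\<omega>. \<sigma> u * (survival d u n \<omega> * u powi (- step S (Suc n) \<omega>)) + stopped d u n \<omega>)"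
  proof (rule integral_cong_AE)
    show "(\<lambda>\<omega>. survival d u (Suc n) \<omega> + stopped d u (Suc n) \<omega>) \<in> borel_measurable M"
      by (intro borel_measurable_add measurable_survival measurable_stopped)
    show "(\<lambda>\<omega>. \<sigma> u * (survival d u n \<omega> * u powi (- step S (Suc n) \<omega>)) + stopped d u n \<omega>) \<in> borel_measurable M"
      by (intro borel_measurable_add measurable_stopped
        borel_measurable_times[OF borel_measurable_const borel_measurable_integrable[OF int(2)]])
    show "AE \<omega> in M. survival d u (Suc n) \<omega> + stopped d u (Suc n) \<omega> =
        \<sigma> u * (survival d u n \<omega> * u powi (- step S (Suc n) \<omega>)) + stopped d u n \<omega>"
      using AE_simple_path by eventually_elim (rule survival_Suc_plus_stopped_Suc[OF u(1)])
  qed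
  also have "\<dots> = \<sigma> u * expectation (\<lambda>\<omega>. survival d u n \<omega> * u powi (- step S (Suc n) \<omega>)) +
      expectation (stopped d u n)"
    using int(2) ints by simp
  also have "\<dots> = expectation (survival d u n) + expectation (stopped d u n)"
    using int(1) sigma_pos[OF u(1)] by simp
  finally show ?case using Suc by simp
qed

lemma expectation_survival_tendsto:
  assumes u: "0 < u" "u < 1" and d: "d > 0"
  shows "(\<lambda>n. expectation (survival d u n)) \<longlonglongrightarrow> 0"
proof (rule tendsto_sandwich)
  note b = survival_bounds[OF u d]
  show "\<forall>\<^sub>F n in sequentially. 0 \<le> expectation (survival d u n)"
    by (intro always_eventually allI integral_nonneg_AE eventually_mono[OF AE_simple_path] b)
  show "\<forall>\<^sub>F n in sequentially. expectation (survival d u n) \<le> \<sigma> u ^ n"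
  proof (intro always_eventually allI)
    fix n
    have "expectation (survival d u n) \<le> expectation (\<lambda>_. \<sigma> u ^ n)"
      by (intro integral_mono_AE integrable_survival[OF u d])
        (use AE_simple_path b in \<open>auto elim!: eventually_mono\<close>)
    then show "expectation (survival d u n) \<le> \<sigma> u ^ n" by (simp add: prob_space)
  qed
  show "(\<lambda>n. \<sigma> u ^ n) \<longlonglongrightarrow> 0"
    using sigma_pos[of u] sigma_less_1[of u] u by (intro LIMSEQ_realpow_zero) auto
qed auto

text \<open>The transform is first computed on the event of hitting. This already forces hitting
  almost surely, which then removes the restriction to that event.\<close>

lemma AE_hit_and_expectation:
  assumes d: "d > 0"
  shows AE_hit: "AE \<omega> in M. \<exists>n. S n \<omega> = int d"
    and expectation_sigma_power_T: "0 < u \<Longrightarrow> u < 1 \<Longrightarrow> expectation (\<lambda>\<omega>. \<sigma> u ^ T d \<omega>) = u ^ d"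
proof -
  define hit where "hit = (\<lambda>\<omega>. \<exists>n. S n \<omega> = int d)"
  have hit_m [measurable]: "Measurable.pred M hit" unfolding hit_def by measurable
  have m: "(\<lambda>\<omega>. \<sigma> u ^ T d \<omega>) \<in> borel_measurable M" for u
    by (rule measurable_compose[OF measurable_T]) auto
  have hm: "(\<lambda>\<omega>. of_bool (hit \<omega>) :: real) \<in> borel_measurable M"
    by (rule measurable_compose[OF hit_m]) auto
  have *: "expectation (\<lambda>\<omega>. \<sigma> u ^ T d \<omega> * of_bool (hit \<omega>)) = u ^ d" if u: "0 < u" "u < 1" for u
  proof (rule LIMSEQ_unique)
    show "(\<lambda>n. expectation (stopped d u n)) \<longlonglongrightarrow>
        expectation (\<lambda>\<omega>. \<sigma> u ^ T d \<omega> * of_bool (hit \<omega>))"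
    proof (rule integral_dominated_convergence[where w="\<lambda>_. 1"])
      show "(\<lambda>\<omega>. \<sigma> u ^ T d \<omega> * of_bool (hit \<omega>)) \<in> borel_measurable M"
        by (intro borel_measurable_times m hm)
      show "AE \<omega> in M. (\<lambda>n. stopped d u n \<omega>) \<longlonglongrightarrow> \<sigma> u ^ T d \<omega> * of_bool (hit \<omega>)"
      proof (intro AE_I2 tendsto_eventually)
        fix \<omega>
        show "\<forall>\<^sub>F n in sequentially. stopped d u n \<omega> = \<sigma> u ^ T d \<omega> * of_bool (hit \<omega>)"
          unfolding eventually_sequentially
        proof (intro exI allI impI)
          \<comment> \<open>The threshold \<open>T d \<omega>\<close> works also on paths that never
            hit: there \<open>unhit\<close> holds for every \<open>n\<close> and both sides are
            \<open>0\<close>.\<close>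
          fix n assume "n \<ge> T d \<omega>"
          then have "unhit d n \<omega> \<longleftrightarrow> \<not> hit \<omega>"
            using unhit_eq_T[of \<omega> d n] by (auto simp: hit_def unhit_def)
          then show "stopped d u n \<omega> = \<sigma> u ^ T d \<omega> * of_bool (hit \<omega>)" by (simp add: stopped_def)
        qed
      qed
      show "AE \<omega> in M. norm (stopped d u n \<omega>) \<le> 1" for n
        using stopped_bounds[OF u] by auto
    qed (auto intro: measurable_stopped)
    have "(\<lambda>n. u ^ d - expectation (survival d u n)) \<longlonglongrightarrow> u ^ d - 0"
      by (intro tendsto_intros expectation_survival_tendsto u d)
    moreover have "u ^ d - expectation (survival d u n) = expectation (stopped d u n)" for n
      using expectation_survival_plus_stopped[OF u d, of n] by simp
    ultimately show "(\<lambda>n. expectation (stopped d u n)) \<longlonglongrightarrow> u ^ d" by simp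
  qed
  \<comment> \<open>As powers of \<open>\<sigma> u\<close> are at most \<open>1\<close>, the
    transform is a lower bound for the hitting probability.\<close>
  have le: "u ^ d \<le> prob {\<omega> \<in> space M. hit \<omega>}" if u: "0 < u" "u < 1" for u
  proof -
    have "u ^ d \<le> expectation (indicator {\<omega> \<in> space M. hit \<omega>})"
      unfolding *[OF u, symmetric]
    proof (rule integral_mono)
      show "integrable M (indicat_real {\<omega> \<in> space M. hit \<omega>})"
        by (rule integrable_real_indicator) (auto simp: emeasure_eq_measure)
      show "\<sigma> u ^ T d \<omega> * of_bool (hit \<omega>) \<le> indicat_real {\<omega> \<in> space M. hit \<omega>} \<omega>"
        if "\<omega> \<in> space M" for \<omega>
        using that u sigma_pos[of u] sigma_le_1[of u] by (auto simp: indicator_def power_le_one)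
      show "integrable M (\<lambda>\<omega>. \<sigma> u ^ T d \<omega> * of_bool (hit \<omega>))"
      proof (rule integrable_const_bound[where B=1])
        show "AE \<omega> in M. norm (\<sigma> u ^ T d \<omega> * of_bool (hit \<omega>)) \<le> 1"
          using u sigma_pos[of u] sigma_le_1[of u] by (auto simp: power_le_one)
      qed (intro borel_measurable_times m hm)
    qed
    then show ?thesis by simp
  qed
  have "1 \<le> prob {\<omega> \<in> space M. hit \<omega>}"
  proof (rule tendsto_upperbound)
    show "((\<lambda>u::real. u ^ d) \<longlongrightarrow> 1) (at_left 1)" by (auto intro!: tendsto_eq_intros)
    show "\<forall>\<^sub>F u in at_left 1. u ^ d \<le> prob {\<omega> \<in> space M. hit \<omega>}"
      using eventually_at_left_real[of 0 "1::real"] by (auto elim!: eventually_mono intro: le)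
  qed auto
  then have "prob {\<omega> \<in> space M. hit \<omega>} = 1" by (simp add: measure_ge_1_iff)
  then have ae: "AE \<omega> in M. hit \<omega>" by (subst (asm) prob_Collect_eq_1) auto
  then show "AE \<omega> in M. \<exists>n. S n \<omega> = int d" by (simp add: hit_def)
  show "expectation (\<lambda>\<omega>. \<sigma> u ^ T d \<omega>) = u ^ d" if "0 < u" "u < 1"
    unfolding *[OF that, symmetric]
    by (rule integral_cong_AE) (use ae m[of u] hm in \<open>auto elim!: eventually_mono\<close>)
qed

section \<open>The ratio as a function of \<open>T\<close>, and Fubini for integrals of powers of
  \<sigma>\<close>

lemma AE_T:
  assumes "d > 0"
  shows "AE \<omega> in M. d \<le> T d \<omega> \<and> up_ratio S d \<omega> = 1 / 2 + real d / 2 * (1 / T d \<omega>)"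
  using AE_simple_path AE_hit[OF assms]
proof eventually_elim
  case (elim \<omega>)
  have "S (T d \<omega>) \<omega> = int d" unfolding T_def using LeastI_ex[OF elim(2)] .
  \<comment> \<open>The bound \<open>d \<le> T d \<omega>\<close> also excludes a zero denominator,
    as \<open>d\<close> is positive.\<close>
  then have "d \<le> T d \<omega>" "2 * int (up_steps S (T d \<omega>) \<omega>) = int (T d \<omega>) + int d"
    using simple_path_le[OF elim(1), of "T d \<omega>"] up_steps_simple_path[OF elim(1), of "T d \<omega>"] by auto
  moreover have "real (up_steps S (T d \<omega>) \<omega>) = (real (T d \<omega>) + real d) / 2"
  proof -
    have "real_of_int (2 * int (up_steps S (T d \<omega>) \<omega>)) = real_of_int (int (T d \<omega>) + int d)"
      by (simp only: calculation(2))
    then show ?thesis by simp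
  qed
  ultimately show ?case
    using elim(2) assms
    by (simp add: up_ratio_def hitting_time_eq_Least field_simps flip: T_def)
qed

lemma continuous_sigma: "continuous_on A \<sigma>"
proof -
  have "p + q * u\<^sup>2 \<noteq> 0" for u using denom_pos[of u] by simp
  then show ?thesis unfolding \<sigma>_def by (intro continuous_intros) auto
qed

text \<open>After exchanging the integrals, the transform of \<open>T\<close> replaces
  \<open>\<sigma> u ^ (T d \<omega> - c)\<close> by \<open>u ^ d / \<sigma> u ^ c\<close>; almost
  surely \<open>c \<le> d \<le> T d \<omega>\<close>, so the subtraction is exact. The cases
  \<open>c = 1\<close> and \<open>c = 2\<close> serve the first and second moments.\<close>

lemma expectation_integral_sigma:
  assumes H: "continuous_on {0..1} H" and d: "0 < d" "c \<le> d"
  shows "expectation (\<lambda>\<omega>. integral {0..1} (\<lambda>u. \<sigma> u ^ (T d \<omega> - c) * H u)) =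
    integral {0..1} (\<lambda>u. u ^ (d - c) * (p + q * u\<^sup>2) ^ c * H u)"
proof -
  \<comment> \<open>The transform of \<open>T\<close> is known for \<open>0 < u < 1\<close> only;
    dropping the endpoints does not change the integral.\<close>
  define P where "P = restrict_space lborel {0<..<1::real}"
  have space_P: "space P = {0<..<1}" by (simp add: P_def space_restrict_space)
  interpret P: finite_measure P
    by (rule finite_measureI) (simp add: P_def space_restrict_space emeasure_restrict_space)
  interpret pair_sigma_finite M P ..
  interpret MP: finite_measure "M \<Otimes>\<^sub>M P"
    by (rule finite_measure_pair_measure) unfold_locales
  have sets_P: "sets P = sets (restrict_space borel {0<..<1})"
    unfolding P_def by (rule sets_restrict_space_cong) simp
  have meas_P: "g \<in> borel_measurable P" if "continuous_on {0..1} g" for g :: "real \<Rightarrow> real"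
    using borel_measurable_continuous_on_restrict[OF continuous_on_subset[OF that, of "{0<..<1}"]]
    by (subst measurable_cong_sets[OF sets_P refl]) (metis greaterThanLessThan_subseteq_atLeastAtMost_iff order_refl)
  have integral_P: "integral\<^sup>L P g = integral {0..1} g" if g: "continuous_on {0..1} g" for g :: "real \<Rightarrow> real"
  proof -
    have "set_integrable lborel {0<..<1} g"
      by (rule set_integrable_subset[OF borel_integrable_atLeastAtMost'[OF g]]) auto
    from set_borel_integral_eq_integral(2)[OF this]
    show ?thesis
      by (simp add: P_def integral_restrict_space set_lebesgue_integral_def integral_open_interval_real)
  qed
  define f where "f = (\<lambda>\<omega> u. \<sigma> u ^ (T d \<omega> - c) * H u)"
  have cont_f: "continuous_on {0..1} (\<lambda>u. \<sigma> u ^ n * H u)" for n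
    by (intro continuous_intros continuous_sigma H)
  obtain K where K: "\<And>u. u \<in> {0..1} \<Longrightarrow> norm (H u) \<le> K"
    using compact_imp_bounded[OF compact_continuous_image[OF H compact_Icc]] unfolding bounded_iff by (metis imageI)
  have "integrable (M \<Otimes>\<^sub>M P) (case_prod f)"
  proof (rule MP.integrable_const_bound)
    show "AE x in M \<Otimes>\<^sub>M P. norm (case_prod f x) \<le> K"
    proof (rule AE_I2)
      fix x assume "x \<in> space (M \<Otimes>\<^sub>M P)"
      then have u: "0 < snd x" "snd x < 1" by (auto simp: space_pair_measure space_P)
      have "norm (H (snd x)) \<le> K" using u by (intro K) auto
      moreover have "\<bar>\<sigma> (snd x) ^ (T d (fst x) - c)\<bar> \<le> 1"
        using sigma_pos[OF u(1)] sigma_le_1[of "snd x"] u by (simp add: power_le_one)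
      ultimately have "\<bar>\<sigma> (snd x) ^ (T d (fst x) - c)\<bar> * norm (H (snd x)) \<le> 1 * K"
        by (intro mult_mono) auto
      then show "norm (case_prod f x) \<le> K"
        by (simp add: f_def case_prod_beta abs_mult)
    qed
    show "case_prod f \<in> borel_measurable (M \<Otimes>\<^sub>M P)"
      unfolding f_def case_prod_beta
    \<comment> \<open>Joint measurability by splitting over the countably many values of
      \<open>T\<close>.\<close>
    proof (rule measurable_compose_countable[where f="\<lambda>n x. \<sigma> (snd x) ^ (n - c) * H (snd x)"
          and g="\<lambda>x. T d (fst x)"])
      show "(\<lambda>x. \<sigma> (snd x) ^ (n - c) * H (snd x)) \<in> borel_measurable (M \<Otimes>\<^sub>M P)" for n
        by (rule measurable_compose[OF measurable_snd meas_P[OF cont_f]])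
      show "(\<lambda>x. T d (fst x)) \<in> measurable (M \<Otimes>\<^sub>M P) (count_space UNIV)"
        by (rule measurable_compose[OF measurable_fst measurable_T])
    qed
  qed
  note fub = Fubini_integral[OF this]
  have "expectation (\<lambda>\<omega>. integral {0..1} (\<lambda>u. \<sigma> u ^ (T d \<omega> - c) * H u)) = (\<integral>\<omega>. (\<integral>u. f \<omega> u \<partial>P) \<partial>M)"
    by (simp add: f_def integral_P[OF cont_f])
  also have "\<dots> = (\<integral>u. (\<integral>\<omega>. f \<omega> u \<partial>M) \<partial>P)" by (rule fub[symmetric])
  also have "\<dots> = (\<integral>u. u ^ (d - c) * (p + q * u\<^sup>2) ^ c * H u \<partial>P)"
  proof (rule Bochner_Integration.integral_cong[OF refl])
    fix u assume "u \<in> space P"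
    then have u: "0 < u" "u < 1" by (auto simp: space_P)
    have m: "(\<lambda>\<omega>. \<sigma> u ^ (T d \<omega> - c)) \<in> borel_measurable M" "(\<lambda>\<omega>. \<sigma> u ^ T d \<omega> / \<sigma> u ^ c) \<in> borel_measurable M"
      by (rule measurable_compose[OF measurable_T]; simp)+
    have "(\<integral>\<omega>. f \<omega> u \<partial>M) = expectation (\<lambda>\<omega>. \<sigma> u ^ (T d \<omega> - c)) * H u"
      by (simp add: f_def)
    also have "expectation (\<lambda>\<omega>. \<sigma> u ^ (T d \<omega> - c)) = expectation (\<lambda>\<omega>. \<sigma> u ^ T d \<omega> / \<sigma> u ^ c)"
    proof (rule integral_cong_AE[OF m])
      show "AE \<omega> in M. \<sigma> u ^ (T d \<omega> - c) = \<sigma> u ^ T d \<omega> / \<sigma> u ^ c"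
        using AE_T[OF d(1)] by eventually_elim (use d sigma_pos[OF u(1)] in \<open>simp add: power_diff\<close>)
    qed
    also have "\<dots> = u ^ d / \<sigma> u ^ c"
      using expectation_sigma_power_T[OF d(1) u] by simp
    also have "\<dots> = u ^ (d - c) * (p + q * u\<^sup>2) ^ c"
      using u d denom_pos[of u] by (simp add: \<sigma>_def power_divide power_diff)
    finally show "(\<integral>\<omega>. f \<omega> u \<partial>M) = u ^ (d - c) * (p + q * u\<^sup>2) ^ c * H u" .
  qed
  also have "\<dots> = integral {0..1} (\<lambda>u. u ^ (d - c) * (p + q * u\<^sup>2) ^ c * H u)"
    by (intro integral_P continuous_intros H)
  finally show ?thesis .
qed

section \<open>The mean of \<open>1 / T\<close>\<close>

definition \<sigma>' :: "real \<Rightarrow> real" where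
  "\<sigma>' u = (p - q * u\<^sup>2) / (p + q * u\<^sup>2)\<^sup>2"

text \<open>For \<open>u > 0\<close> this is \<open>u * \<sigma>' u / \<sigma> u\<close>, the factor
  left once the transform of \<open>T\<close> has been inserted.\<close>

definition g :: "real \<Rightarrow> real" where
  "g u = (p - q * u\<^sup>2) / (p + q * u\<^sup>2)"

text \<open>The negated derivative of \<open>g\<close>, which is nonnegative on the unit
  interval.\<close>

definition v :: "real \<Rightarrow> real" where
  "v u = 4 * p * q * u / (p + q * u\<^sup>2)\<^sup>2"

lemma DERIV_sigma: "(\<sigma> has_real_derivative \<sigma>' u) (at u)"
  unfolding \<sigma>_def \<sigma>'_def using denom_pos[of u]
  by (auto intro!: derivative_eq_intros simp: power2_eq_square algebra_simps)

lemma DERIV_g: "(g has_real_derivative - v u) (at u)"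
  unfolding g_def v_def using denom_pos[of u]
  by (auto intro!: derivative_eq_intros simp: divide_simps power2_eq_square) (auto simp: algebra_simps)

lemma sigma_0 [simp]: "\<sigma> 0 = 0" and sigma_1 [simp]: "\<sigma> 1 = 1"
  and g_1: "g 1 = p - q"
  by (simp_all add: \<sigma>_def g_def) (simp_all add: q_eq)

lemma denom_nz: "p + q * u\<^sup>2 \<noteq> 0"
  using denom_pos[of u] by simp

lemma continuous_sigma': "continuous_on A \<sigma>'"
  and continuous_g: "continuous_on A g" and continuous_v: "continuous_on A v"
  unfolding \<sigma>'_def g_def v_def using denom_nz by (auto intro!: continuous_intros)

text \<open>Substitution along \<sigma>, which fixes both endpoints. With
  \<open>n = T d \<omega> - 1\<close> the value is \<open>1 / T d \<omega>\<close>.\<close>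

lemma integral_sigma_power:
  "((\<lambda>u. \<sigma> u ^ n * \<sigma>' u) has_integral 1 / (real n + 1)) {0..1}"
proof -
  have "((\<lambda>u. \<sigma> u ^ n * \<sigma>' u) has_integral \<sigma> 1 ^ Suc n / (real n + 1) - \<sigma> 0 ^ Suc n / (real n + 1)) {0..1}"
  proof (rule has_integral_FTC_01)
    show "((\<lambda>u. \<sigma> u ^ Suc n / (real n + 1)) has_real_derivative \<sigma> u ^ n * \<sigma>' u) (at u)" for u
    proof -
      have "((\<lambda>u. \<sigma> u ^ Suc n / (real n + 1)) has_real_derivative
          (1 + real n) * (\<sigma>' u * \<sigma> u ^ n) / (real n + 1)) (at u)"
        by (intro DERIV_cdivide DERIV_power_Suc DERIV_sigma)
      then show ?thesis by (simp add: add.commute mult.commute)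
    qed
  qed
  then show ?thesis by simp
qed

lemma expectation_inverse_T:
  assumes d: "0 < d"
  shows "real d * expectation (\<lambda>\<omega>. 1 / T d \<omega>) = p - q + integral {0..1} (\<lambda>u. u ^ d * v u)"
proof -
  have "expectation (\<lambda>\<omega>. 1 / T d \<omega>) =
      expectation (\<lambda>\<omega>. integral {0..1} (\<lambda>u. \<sigma> u ^ (T d \<omega> - 1) * \<sigma>' u))"
  proof (rule integral_cong_AE)
    show "AE \<omega> in M. 1 / T d \<omega> = integral {0..1} (\<lambda>u. \<sigma> u ^ (T d \<omega> - 1) * \<sigma>' u)"
      using AE_T[OF d]
    proof eventually_elim
      case (elim \<omega>)
      then show ?case
        using d integral_unique[OF integral_sigma_power[of "T d \<omega> - 1"]] by (simp add: of_nat_diff)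
    qed
  qed (rule measurable_compose[OF measurable_T]; simp)+
  also have "\<dots> = integral {0..1} (\<lambda>u. u ^ (d - 1) * (p + q * u\<^sup>2) ^ 1 * \<sigma>' u)"
    using d by (intro expectation_integral_sigma continuous_sigma') auto
  also have "(\<lambda>u. u ^ (d - 1) * (p + q * u\<^sup>2) ^ 1 * \<sigma>' u) = (\<lambda>u. u ^ (d - 1) * g u)"
    using denom_nz by (auto simp: \<sigma>'_def g_def power2_eq_square fun_eq_iff)
  finally have eq: "expectation (\<lambda>\<omega>. 1 / T d \<omega>) = integral {0..1} (\<lambda>u. u ^ (d - 1) * g u)" .
  have i: "(\<lambda>u. u ^ (d - 1) * g u) integrable_on {0..1}" "(\<lambda>u. u ^ d * v u) integrable_on {0..1}"
    by (intro integrable_continuous_real continuous_intros continuous_g continuous_v)+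
  \<comment> \<open>Integration by parts, written as the fundamental theorem for
    \<open>u ^ d * g u\<close>; the boundary term at \<open>0\<close> vanishes because
    \<open>d > 0\<close>.\<close>
  have "((\<lambda>u. real d * (u ^ (d - 1) * g u) - u ^ d * v u) has_integral 1 ^ d * g 1 - 0 ^ d * g 0) {0..1}"
  proof (rule has_integral_FTC_01)
    show "((\<lambda>u. u ^ d * g u) has_real_derivative real d * (u ^ (d - 1) * g u) - u ^ d * v u) (at u)" for u
      by (rule derivative_eq_intros DERIV_g refl)+ (auto simp: field_simps)
  qed
  then have "p - q = integral {0..1} (\<lambda>u. real d * (u ^ (d - 1) * g u) - u ^ d * v u)"
    using d by (simp add: integral_unique g_1)
  also have "\<dots> = real d * integral {0..1} (\<lambda>u. u ^ (d - 1) * g u) - integral {0..1} (\<lambda>u. u ^ d * v u)"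
    using i by (subst Henstock_Kurzweil_Integration.integral_diff) (auto intro: integrable_on_mult_right)
  finally show ?thesis by (simp add: eq)
qed

section \<open>Decay and strict monotonicity of the remainder integral\<close>

lemma denom_le_1: "0 \<le> u \<Longrightarrow> u \<le> 1 \<Longrightarrow> p + q * u\<^sup>2 \<le> 1"
proof -
  assume "0 \<le> u" "u \<le> 1"
  then have "q * u\<^sup>2 \<le> q * 1"
    using q_pos by (intro mult_left_mono) (auto simp: power_le_one)
  then show ?thesis using q_eq by linarith
qed

lemma p_le_denom: "p \<le> p + q * u\<^sup>2"
  using q_pos by simp

text \<open>The denominator \<open>p + q * u\<^sup>2\<close> lies between \<open>p\<close> and
  \<open>1\<close>. The lower bound serves strict monotonicity, the upper bound the limits.\<close>

lemma v_bounds: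
  assumes "0 \<le> u" "u \<le> 1"
  shows "4 * p * q * u \<le> v u" "v u \<le> 8"
proof -
  have pos: "0 \<le> 4 * p * q * u" using p_pos q_pos assms by simp
  have D: "(p + q * u\<^sup>2)\<^sup>2 \<le> 1" "0 < (p + q * u\<^sup>2)\<^sup>2" "p\<^sup>2 \<le> (p + q * u\<^sup>2)\<^sup>2"
    using denom_le_1[OF assms] denom_pos[of u] p_le_denom[of u] p_pos
    by (auto intro!: power_le_one power_mono)
  then show "4 * p * q * u \<le> v u"
    unfolding v_def using mult_left_mono[OF D(1) pos] by (simp add: pos_le_divide_eq)
  have "q * u \<le> q * 1" using q_pos assms by (intro mult_left_mono) auto
  \<comment> \<open>The constant \<open>8\<close> arises from \<open>q * u \<le> 2 * p\<close> and
    the lower bound \<open>p\<^sup>2\<close> for the squared denominator.\<close>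
  then have "4 * p * (q * u) \<le> 4 * p * (2 * p)"
    using q_le_p p_pos by (intro mult_left_mono) auto
  also have "\<dots> = 8 * p\<^sup>2" by (simp add: power2_eq_square)
  also have "\<dots> \<le> 8 * (p + q * u\<^sup>2)\<^sup>2" using D(3) by simp
  finally show "v u \<le> 8"
    unfolding v_def using D(2) by (simp add: pos_divide_le_eq mult.assoc)
qed

lemma integrable_power_v: "(\<lambda>u. u ^ n * v u) integrable_on {0..1}"
  by (intro integrable_continuous_real continuous_intros continuous_v)

lemma integral_power_v_bounds:
  "0 \<le> integral {0..1} (\<lambda>u. u ^ n * v u)" "integral {0..1} (\<lambda>u. u ^ n * v u) \<le> 8 / (real n + 1)"
proof -
  have v0: "0 \<le> v u" if "0 \<le> u" "u \<le> 1" for u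
    by (rule order_trans[OF _ v_bounds(1)[OF that]]) (use that p_pos q_pos in auto)
  then show "0 \<le> integral {0..1} (\<lambda>u. u ^ n * v u)"
    by (intro integral_nonneg integrable_power_v) auto
  have "((\<lambda>u. u ^ n * 8) has_integral 1 / (real n + 1) * 8) {0..1}"
    by (intro has_integral_mult_left has_integral_power_01)
  from has_integral_le[OF integrable_integral[OF integrable_power_v[of n]] this]
  show "integral {0..1} (\<lambda>u. u ^ n * v u) \<le> 8 / (real n + 1)"
    using v_bounds(2) by (simp add: mult_left_mono)
qed

text \<open>The integrands differ by \<open>u ^ n * (1 - u) * v u\<close>. Replacing
  \<open>v u\<close> by its linear lower bound leaves an explicit integral that is positive since
  \<open>p\<close> and \<open>q\<close> are.\<close>

lemma integral_power_v_strict_decseq: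
  "integral {0..1} (\<lambda>u. u ^ Suc n * v u) < integral {0..1} (\<lambda>u. u ^ n * v u)"
proof -
  have "((\<lambda>u. 4 * p * q * (u ^ (n + 1) - u ^ (n + 2))) has_integral
      4 * p * q * (1 / (real (n + 1) + 1) - 1 / (real (n + 2) + 1))) {0..1}"
    by (intro has_integral_mult_right has_integral_diff has_integral_power_01)
  moreover have "((\<lambda>u. u ^ n * v u - u ^ Suc n * v u) has_integral
      integral {0..1} (\<lambda>u. u ^ n * v u) - integral {0..1} (\<lambda>u. u ^ Suc n * v u)) {0..1}"
    by (intro has_integral_diff integrable_integral integrable_power_v)
  ultimately have "4 * p * q * (1 / (real (n + 1) + 1) - 1 / (real (n + 2) + 1)) \<le>
      integral {0..1} (\<lambda>u. u ^ n * v u) - integral {0..1} (\<lambda>u. u ^ Suc n * v u)"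
  proof (rule has_integral_le)
    fix u :: real assume u: "u \<in> {0..1}"
    have "(u ^ n * (1 - u)) * (4 * p * q * u) \<le> (u ^ n * (1 - u)) * v u"
      using u v_bounds(1)[of u] by (intro mult_left_mono) auto
    then show "4 * p * q * (u ^ (n + 1) - u ^ (n + 2)) \<le> u ^ n * v u - u ^ Suc n * v u"
      by (simp add: algebra_simps)
  qed
  moreover have "0 < 4 * p * q * (1 / (real (n + 1) + 1) - 1 / (real (n + 2) + 1))"
    using p_pos q_pos by (intro mult_pos_pos) (auto intro: frac_less2)
  ultimately show ?thesis by linarith
qed

section \<open>The second moment of \<open>1 / T\<close>\<close>

lemma g_le: assumes "0 \<le> u" "u \<le> 1" shows "g u \<le> p - q + 4 * (1 - u)"
proof -
  have "g u = (p - q) + 2 * q * (p * (1 - u\<^sup>2) / (p + q * u\<^sup>2))"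
  proof -
    \<comment> \<open>By \<open>p + q = 1\<close> this splits off \<open>p - q\<close>, the value of
      \<open>g\<close> at \<open>1\<close>; the rest contains a factor \<open>1 - u\<close>.\<close>
    have "p - q * u\<^sup>2 = (p - q) * (p + q * u\<^sup>2) + 2 * q * (p * (1 - u\<^sup>2))"
      unfolding q_eq by (simp add: algebra_simps power2_eq_square)
    then show ?thesis using denom_nz[of u] by (simp add: g_def add_divide_distrib)
  qed
  also have "p * (1 - u\<^sup>2) / (p + q * u\<^sup>2) \<le> 1 - u\<^sup>2"
    using mult_left_mono[OF p_le_denom[of u], of "1 - u\<^sup>2"] denom_pos[of u] assms
    by (simp add: pos_divide_le_eq power_le_one mult.commute[of p])
  also have "1 - u\<^sup>2 = (1 - u) * (1 + u)" by (simp add: algebra_simps power2_eq_square)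
  also have "\<dots> \<le> (1 - u) * 2" using assms by (intro mult_left_mono) auto
  finally have "g u \<le> (p - q) + 2 * q * ((1 - u) * 2)" using q_pos by simp
  also have "q * (1 - u) \<le> 1 * (1 - u)" using assms p_pos q_eq by (intro mult_right_mono) auto
  then have "(p - q) + 2 * q * ((1 - u) * 2) \<le> p - q + 4 * (1 - u)"
    by (simp add: algebra_simps)
  finally show ?thesis .
qed

text \<open>Both \<open>p - q * u\<close> and \<open>g u\<close> exceed \<open>p - q\<close> by at
  most a multiple of \<open>1 - u\<close>, so the error is of second order at \<open>u = 1\<close>,
  near which the weight \<open>u ^ (d - 2)\<close> concentrates for large \<open>d\<close>.\<close>

lemma second_moment_integrand_le:
  assumes "0 \<le> u" "u \<le> 1"
  shows "(1 - u) * (p - q * u) * g u \<le> (1 - u) * (p - q)\<^sup>2 + 9 * (1 - u)\<^sup>2"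
proof -
  let ?t = "1 - u"
  have g0: "0 \<le> g u"
  proof -
    have "q * u\<^sup>2 \<le> q * 1" using q_pos assms by (intro mult_left_mono) (auto simp: power_le_one)
    then show ?thesis unfolding g_def using denom_pos[of u] q_le_p by (intro divide_nonneg_pos) auto
  qed
  have "q * ?t \<le> 1 * ?t" using assms p_pos q_eq by (intro mult_right_mono) auto
  then have "p - q * u \<le> p - q + ?t" by (simp add: algebra_simps)
  then have "(p - q * u) * g u \<le> (p - q + ?t) * (p - q + 4 * ?t)"
    using g_le[OF assms] g0 q_le_p assms by (intro mult_mono) auto
  also have "\<dots> = (p - q)\<^sup>2 + 5 * ((p - q) * ?t) + 4 * (?t * ?t)"
    by (simp add: algebra_simps power2_eq_square)
  \<comment> \<open>Replacing \<open>p - q\<close> and one factor \<open>1 - u\<close> by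
    \<open>1\<close> gives the constant \<open>9 = 5 + 4\<close>.\<close>
  also have "\<dots> \<le> (p - q)\<^sup>2 + 5 * (1 * ?t) + 4 * (1 * ?t)"
    using assms q_pos q_eq by (intro add_mono mult_left_mono mult_right_mono) auto
  finally have "?t * ((p - q * u) * g u) \<le> ?t * ((p - q)\<^sup>2 + 9 * ?t)"
    using assms by (intro mult_left_mono) auto
  then show ?thesis by (simp add: algebra_simps power2_eq_square)
qed

text \<open>Multiplied by \<open>d\<^sup>2\<close>, the first summand tends to
  \<open>(p - q)\<^sup>2\<close>, while the second is of order \<open>1 / d\<close>.\<close>

lemma expectation_inverse_T_square_le:
  assumes d: "2 \<le> d"
  shows "expectation (\<lambda>\<omega>. (1 / T d \<omega>)\<^sup>2) \<le>
    (p - q)\<^sup>2 * (1 / (real d - 1) - 1 / d) + 9 * (1 / (real d - 1) - 2 / d + 1 / (real d + 1))"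
proof -
  let ?H = "\<lambda>u. (1 - \<sigma> u) * \<sigma>' u"
  have d0: "0 < d" using d by simp
  \<comment> \<open>With \<open>n = T d \<omega> - 2\<close> the value is
    \<open>1 / (T (T - 1))\<close> for \<open>T = T d \<omega>\<close>.\<close>
  have H: "integral {0..1} (\<lambda>u. \<sigma> u ^ n * ?H u) = 1 / (real n + 1) - 1 / (real n + 2)" for n
  proof -
    have "((\<lambda>u. \<sigma> u ^ n * \<sigma>' u - \<sigma> u ^ Suc n * \<sigma>' u) has_integral
        1 / (real n + 1) - 1 / (real (Suc n) + 1)) {0..1}"
      by (intro has_integral_diff integral_sigma_power)
    moreover have "(\<lambda>u. \<sigma> u ^ n * \<sigma>' u - \<sigma> u ^ Suc n * \<sigma>' u) = (\<lambda>u. \<sigma> u ^ n * ?H u)"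
      by (auto simp: algebra_simps)
    ultimately show ?thesis by (simp add: integral_unique add.commute)
  qed
  define Z where "Z = (\<lambda>\<omega>. integral {0..1} (\<lambda>u. \<sigma> u ^ (T d \<omega> - 2) * ?H u))"
  have Z_m: "Z \<in> borel_measurable M"
    unfolding Z_def by (rule measurable_compose[OF measurable_T]) simp
  \<comment> \<open>Holds on every path, also where the subtraction \<open>T d \<omega> - 2\<close>
    is truncated.\<close>
  have Z_le_1: "\<bar>Z \<omega>\<bar> \<le> 1" for \<omega>
  proof -
    let ?n = "real (T d \<omega> - 2)"
    have "1 / (?n + 1) \<le> 1" "1 / (?n + 2) \<le> 1" "0 \<le> 1 / (?n + 1)" "0 \<le> 1 / (?n + 2)" by auto
    then show ?thesis unfolding Z_def H by linarith
  qed
  have le: "AE \<omega> in M. (1 / T d \<omega>)\<^sup>2 \<le> Z \<omega>"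
    using AE_T[OF d0]
  proof eventually_elim
    case (elim \<omega>)
    then have n: "2 \<le> real (T d \<omega>)" using d by simp
    then have "Z \<omega> = 1 / (real (T d \<omega>) - 1) - 1 / T d \<omega>"
      unfolding Z_def H by (simp add: of_nat_diff)
    also have "\<dots> = 1 / (real (T d \<omega>) * (real (T d \<omega>) - 1))" using n by (simp add: field_simps)
    also have "\<dots> \<ge> 1 / (real (T d \<omega>) * real (T d \<omega>))"
      using n by (intro divide_left_mono mult_left_mono) auto
    finally show ?case by (simp add: power2_eq_square)
  qed
  have m: "(\<lambda>\<omega>. (1 / T d \<omega>)\<^sup>2) \<in> borel_measurable M"
    by (rule measurable_compose[OF measurable_T]) simp
  have "expectation (\<lambda>\<omega>. (1 / T d \<omega>)\<^sup>2) \<le> expectation Z"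
  proof (rule integral_mono_AE)
    show "integrable M (\<lambda>\<omega>. (1 / T d \<omega>)\<^sup>2)"
    proof (rule integrable_const_bound[where B=1, OF _ m])
      show "AE \<omega> in M. norm ((1 / T d \<omega>)\<^sup>2) \<le> 1"
        using le by (auto elim!: eventually_mono intro: order_trans[OF _ order_trans[OF abs_ge_self Z_le_1]])
    qed
    show "integrable M Z" by (rule integrable_const_bound[where B=1, OF _ Z_m]) (use Z_le_1 in auto)
  qed (rule le)
  also have "expectation Z = integral {0..1} (\<lambda>u. u ^ (d - 2) * (p + q * u\<^sup>2)\<^sup>2 * ?H u)"
    unfolding Z_def using d
    by (intro expectation_integral_sigma continuous_intros continuous_sigma continuous_sigma') auto
  \<comment> \<open>The squared factor from \<open>c = 2\<close> cancels all denominators of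
    \<open>1 - \<sigma> u\<close> and \<open>\<sigma>' u\<close> except the one kept in
    \<open>g\<close>.\<close>
  also have "\<dots> = integral {0..1} (\<lambda>u. u ^ (d - 2) * ((1 - u) * (p - q * u) * g u))"
    unfolding one_minus_sigma using denom_nz
    by (intro arg_cong[where f="integral {0..1}"])
      (auto simp: \<sigma>'_def g_def power2_eq_square fun_eq_iff)
  also have "\<dots> \<le> (p - q)\<^sup>2 * (1 / (real (d - 2) + 1) - 1 / (real (d - 1) + 1)) +
      9 * (1 / (real (d - 2) + 1) - 2 * (1 / (real (d - 1) + 1)) + 1 / (real d + 1))"
  proof (rule has_integral_le)
    show "((\<lambda>u. u ^ (d - 2) * ((1 - u) * (p - q * u) * g u)) has_integral
        integral {0..1} (\<lambda>u. u ^ (d - 2) * ((1 - u) * (p - q * u) * g u))) {0..1}"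
      by (intro integrable_integral integrable_continuous_real continuous_intros continuous_g)
    show "((\<lambda>u. (p - q)\<^sup>2 * (u ^ (d - 2) - u ^ (d - 1)) + 9 * (u ^ (d - 2) - 2 * u ^ (d - 1) + u ^ d))
      has_integral (p - q)\<^sup>2 * (1 / (real (d - 2) + 1) - 1 / (real (d - 1) + 1)) +
      9 * (1 / (real (d - 2) + 1) - 2 * (1 / (real (d - 1) + 1)) + 1 / (real d + 1))) {0..1}"
      by (intro has_integral_add has_integral_diff has_integral_mult_right has_integral_power_01)
    fix u :: real assume u: "u \<in> {0..1}"
    have "u ^ (d - 2) * ((1 - u) * (p - q * u) * g u) \<le> u ^ (d - 2) * ((1 - u) * (p - q)\<^sup>2 + 9 * (1 - u)\<^sup>2)"
      using u second_moment_integrand_le[of u] by (intro mult_left_mono) auto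
    also have "\<dots> = (p - q)\<^sup>2 * (u ^ (d - 2) - u ^ (d - 2) * u) +
        9 * (u ^ (d - 2) - 2 * (u ^ (d - 2) * u) + u ^ (d - 2) * u * u)"
      by (simp add: algebra_simps power2_eq_square)
    also have "u ^ (d - 2) * u = u ^ (d - 1)" using d Suc_diff_Suc[of 1 d] by (simp add: numeral_2_eq_2 flip: power_Suc2)
    also have "u ^ (d - 1) * u = u ^ d" using d by (simp flip: power_Suc2)
    finally show "u ^ (d - 2) * ((1 - u) * (p - q * u) * g u) \<le>
      (p - q)\<^sup>2 * (u ^ (d - 2) - u ^ (d - 1)) + 9 * (u ^ (d - 2) - 2 * u ^ (d - 1) + u ^ d)" .
  qed
  also have "\<dots> = (p - q)\<^sup>2 * (1 / (real d - 1) - 1 / d) + 9 * (1 / (real d - 1) - 2 / d + 1 / (real d + 1))"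
    using d by (simp add: of_nat_diff)
  finally show ?thesis .
qed

section \<open>Mean and variance of the ratio and their limits\<close>

lemma integrable_inverse_T: "integrable M (\<lambda>\<omega>. 1 / real (T d \<omega>))"
  and integrable_inverse_T_square: "integrable M (\<lambda>\<omega>. (1 / real (T d \<omega>))\<^sup>2)"
proof -
  \<comment> \<open>Covers \<open>n = 0\<close> too, where the quotient is \<open>0\<close> by
    convention.\<close>
  have b: "\<bar>1 / real n\<bar> \<le> 1" for n by (cases n) auto
  show "integrable M (\<lambda>\<omega>. 1 / real (T d \<omega>))"
    by (rule integrable_const_bound[where B=1])
      (use b measurable_compose[OF measurable_T] in auto)
  have b2: "\<bar>(1 / real n)\<^sup>2\<bar> \<le> 1" for n using power_le_one[of "\<bar>1 / real n\<bar>" 2] b[of n] by simp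
  show "integrable M (\<lambda>\<omega>. (1 / real (T d \<omega>))\<^sup>2)"
    by (rule integrable_const_bound[where B=1])
      (use b2 in simp, rule measurable_compose[OF measurable_T], simp)
qed

text \<open>\<open>integral_cong_AE\<close> asks for this when the ratio is replaced by its almost
  sure formula. The count of up-steps is a finite sum of indicators, and the random index
  \<open>T\<close> takes countably many values.\<close>

lemma measurable_up_ratio: "up_ratio S d \<in> borel_measurable M"
proof -
  have up: "(\<lambda>\<omega>. real (up_steps S n \<omega>)) \<in> borel_measurable M" for n
  proof -
    have "(\<lambda>\<omega>. \<Sum>k\<in>{1..n}. indicator {\<omega> \<in> space M. step S k \<omega> = 1} \<omega> :: real) \<in> borel_measurable M"
    proof (intro borel_measurable_sum borel_measurable_indicator)
      fix k assume "k \<in> {1..n}"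
      then have [measurable]: "step S k \<in> measurable M (count_space UNIV)" by (intro measurable_step) auto
      show "{\<omega> \<in> space M. step S k \<omega> = 1} \<in> events" by measurable
    qed
    then show ?thesis
      by (rule measurable_cong[THEN iffD1, rotated])
        (auto simp: up_steps_def indicator_def sum.If_cases Int_def)
  qed
  have hit: "Measurable.pred M (\<lambda>\<omega>. \<exists>n. S n \<omega> = int d)" by measurable
  have "(\<lambda>\<omega>. if \<exists>n. S n \<omega> = int d then real (up_steps S (T d \<omega>) \<omega>) / real (T d \<omega>) else 0) \<in> borel_measurable M"
  proof (rule measurable_If)
    show "{\<omega> \<in> space M. \<exists>n. S n \<omega> = int d} \<in> events" using hit by (simp add: pred_def)
    show "(\<lambda>\<omega>. real (up_steps S (T d \<omega>) \<omega>) / real (T d \<omega>)) \<in> borel_measurable M"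
      by (rule measurable_compose_countable[where f="\<lambda>n \<omega>. real (up_steps S n \<omega>) / real n", OF _ measurable_T])
        (intro borel_measurable_divide up borel_measurable_const)
  qed (rule borel_measurable_const)
  then show ?thesis
    by (simp add: up_ratio_def[abs_def] hitting_time_eq_Least T_def if_distrib cong: if_cong)
qed

text \<open>Here \<open>1 / 2 + (p - q) / 2\<close> becomes \<open>p\<close>; the integral alone
  depends on \<open>d\<close> and carries both monotonicity and limit.\<close>

lemma expectation_up_ratio:
  assumes d: "0 < d"
  shows "expectation (up_ratio S d) = p + integral {0..1} (\<lambda>u. u ^ d * v u) / 2"
proof -
  have "expectation (up_ratio S d) = expectation (\<lambda>\<omega>. 1 / 2 + real d / 2 * (1 / T d \<omega>))"
  proof (rule integral_cong_AE[OF measurable_up_ratio])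
    show "AE \<omega> in M. up_ratio S d \<omega> = 1 / 2 + real d / 2 * (1 / T d \<omega>)"
      using AE_T[OF d] by eventually_elim auto
  qed (rule measurable_compose[OF measurable_T], simp)
  also have "\<dots> = expectation (\<lambda>_. 1 / 2) + expectation (\<lambda>\<omega>. real d / 2 * (1 / T d \<omega>))"
    by (intro Bochner_Integration.integral_add integrable_mult_right integrable_inverse_T integrable_const)
  also have "\<dots> = 1 / 2 + real d / 2 * expectation (\<lambda>\<omega>. 1 / T d \<omega>)"
    by (simp only: integral_mult_right_zero) (simp add: prob_space)
  also have "\<dots> = 1 / 2 + (real d * expectation (\<lambda>\<omega>. 1 / T d \<omega>)) / 2" by simp
  finally show ?thesis
    unfolding expectation_inverse_T[OF d] by (simp add: q_eq field_simps)
qed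

text \<open>The ratio is almost surely affine in \<open>1 / T\<close> with slope
  \<open>real d / 2\<close>.\<close>

lemma variance_up_ratio:
  assumes d: "0 < d"
  shows "variance (up_ratio S d) =
    (real d)\<^sup>2 / 4 * (expectation (\<lambda>\<omega>. (1 / T d \<omega>)\<^sup>2) - (expectation (\<lambda>\<omega>. 1 / T d \<omega>))\<^sup>2)"
proof -
  let ?Y = "\<lambda>\<omega>. 1 / real (T d \<omega>)"
  have mean: "expectation (up_ratio S d) = 1 / 2 + real d / 2 * expectation ?Y"
    unfolding expectation_up_ratio[OF d] using expectation_inverse_T[OF d] by (simp add: q_eq field_simps)
  have "variance (up_ratio S d) = expectation (\<lambda>\<omega>. (real d)\<^sup>2 / 4 * (?Y \<omega> - expectation ?Y)\<^sup>2)"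
  proof (rule integral_cong_AE)
    show "AE \<omega> in M. (up_ratio S d \<omega> - expectation (up_ratio S d))\<^sup>2 =
        (real d)\<^sup>2 / 4 * (?Y \<omega> - expectation ?Y)\<^sup>2"
      using AE_T[OF d]
    proof eventually_elim
      case (elim \<omega>)
      then have "up_ratio S d \<omega> - expectation (up_ratio S d) = real d / 2 * (?Y \<omega> - expectation ?Y)"
        unfolding mean by (simp add: algebra_simps)
      then have "(up_ratio S d \<omega> - expectation (up_ratio S d))\<^sup>2 = (real d / 2)\<^sup>2 * (?Y \<omega> - expectation ?Y)\<^sup>2"
        by (simp only: power_mult_distrib)
      then show ?case by (simp only: power_divide) simp
    qed
    show "(\<lambda>\<omega>. (up_ratio S d \<omega> - expectation (up_ratio S d))\<^sup>2) \<in> borel_measurable M"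
      by (intro borel_measurable_power borel_measurable_diff measurable_up_ratio borel_measurable_const)
  qed (rule measurable_compose[OF measurable_T], simp)
  also have "\<dots> = (real d)\<^sup>2 / 4 * variance ?Y" by simp
  finally show ?thesis
    by (simp only: variance_eq[OF integrable_inverse_T integrable_inverse_T_square])
qed

lemma expectation_up_ratio_tendsto: "(\<lambda>d. expectation (up_ratio S d)) \<longlonglongrightarrow> p"
proof (rule tendsto_sandwich)
  show "\<forall>\<^sub>F d in sequentially. p \<le> expectation (up_ratio S d)"
    using eventually_gt_at_top[of 0]
    by eventually_elim (use integral_power_v_bounds(1) in \<open>simp add: expectation_up_ratio\<close>)
  show "\<forall>\<^sub>F d in sequentially. expectation (up_ratio S d) \<le> p + 4 / (real d + 1)"
    using eventually_gt_at_top[of 0]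
  proof eventually_elim
    case (elim d)
    then show ?case using integral_power_v_bounds(2)[of d] by (simp add: expectation_up_ratio)
  qed
  show "(\<lambda>d. p + 4 / (real d + 1)) \<longlonglongrightarrow> p" by real_asymp
qed auto

text \<open>In the upper bound \<open>?b\<close>, the scaled second moment tends to
  \<open>(p - q)\<^sup>2 / 4\<close>, which cancels the lower bound for the scaled squared
  mean.\<close>

lemma variance_up_ratio_tendsto: "(\<lambda>d. variance (up_ratio S d)) \<longlonglongrightarrow> 0"
proof (rule tendsto_sandwich)
  let ?b = "\<lambda>d::nat. (real d)\<^sup>2 / 4 * ((p - q)\<^sup>2 * (1 / (real d - 1) - 1 / d) +
    9 * (1 / (real d - 1) - 2 / d + 1 / (real d + 1))) - (p - q)\<^sup>2 / 4"
  show "\<forall>\<^sub>F d in sequentially. 0 \<le> variance (up_ratio S d)"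
    by (intro always_eventually allI variance_positive)
  show "\<forall>\<^sub>F d in sequentially. variance (up_ratio S d) \<le> ?b d"
    using eventually_ge_at_top[of 2]
  proof eventually_elim
    case (elim d)
    \<comment> \<open>Squaring is monotone here because \<open>q \<le> p\<close>.\<close>
    have "(p - q)\<^sup>2 \<le> (real d * expectation (\<lambda>\<omega>. 1 / T d \<omega>))\<^sup>2"
      using expectation_inverse_T[of d] integral_power_v_bounds(1)[of d] elim q_le_p
      by (intro power_mono) auto
    moreover have "(real d)\<^sup>2 / 4 * expectation (\<lambda>\<omega>. (1 / T d \<omega>)\<^sup>2) \<le> (real d)\<^sup>2 / 4 * ((p - q)\<^sup>2 * (1 / (real d - 1) - 1 / d) +
        9 * (1 / (real d - 1) - 2 / d + 1 / (real d + 1)))"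
      by (intro mult_left_mono expectation_inverse_T_square_le elim) auto
    moreover have "variance (up_ratio S d) =
        (real d)\<^sup>2 / 4 * expectation (\<lambda>\<omega>. (1 / T d \<omega>)\<^sup>2) -
        (real d * expectation (\<lambda>\<omega>. 1 / T d \<omega>))\<^sup>2 / 4"
      using elim by (subst variance_up_ratio) (auto simp: right_diff_distrib power_mult_distrib)
    ultimately show ?case by linarith
  qed
  \<comment> \<open>Generalizing \<open>(p - q)\<^sup>2\<close> to \<open>c\<close> leaves the
    asymptotic expansion with a single parameter.\<close>
  have "(\<lambda>d::nat. (real d)\<^sup>2 / 4 * (c * (1 / (real d - 1) - 1 / d) +
    9 * (1 / (real d - 1) - 2 / d + 1 / (real d + 1))) - c / 4) \<longlonglongrightarrow> 0" for c :: real
    by real_asymp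
  then show "?b \<longlonglongrightarrow> 0" .
qed auto

end

theorem corollary2p2:
  fixes M :: "'a measure" and S :: "nat \<Rightarrow> 'a \<Rightarrow> int" and p q :: real
  assumes "prob_space M"
    and "1 / 2 \<le> p" and "p < 1" and "q = 1 - p"
    and "\<forall>\<omega>\<in>space M. S 0 \<omega> = 0"
    and "prob_space.indep_vars M (\<lambda>_. count_space UNIV) (step S) {1..}"
    and "\<forall>n\<ge>1. measure M {\<omega> \<in> space M. step S n \<omega> = 1} = p"
    and "\<forall>n\<ge>1. measure M {\<omega> \<in> space M. step S n \<omega> = - 1} = q"
  shows "(\<forall>d\<ge>1. prob_space.expectation M (up_ratio S d)
                > prob_space.expectation M (up_ratio S (d + 1)))
    \<and> (\<lambda>d. prob_space.expectation M (up_ratio S d)) \<longlonglongrightarrow> p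
    \<and> (\<lambda>d. prob_space.variance M (up_ratio S d)) \<longlonglongrightarrow> 0"
proof -
  interpret prob_space M by fact
  interpret biased_walk M S p q
    by unfold_locales (use assms in auto)
  have "expectation (up_ratio S (d + 1)) < expectation (up_ratio S d)" if "d \<ge> 1" for d
    using that integral_power_v_strict_decseq[of d] by (simp add: expectation_up_ratio)
  then show ?thesis
    using expectation_up_ratio_tendsto variance_up_ratio_tendsto by blast
qed

end
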